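(* Let $p$ be any prime and $n\ge k\ge 1$ integers. Then $S(n,k)$ is a minimum zero case (MZC) if and only if $S(n+1,k+1)$ is a shifted minimum zero case (SMZC). If $S(n,k)$ is a MZC and/or $S(n+1,k+1)$ is a SMZC, then $$\nu_p(S(n,k))=\nu_p(S(n+1,k+1))=\frac{\sigma_p(k)-\sigma_p(n)}{p-1}.$$
   Context: $S(n,k)$ is the Stirling number of the second kind; $\sigma_p(m)$ is the sum of the base $p$ digits of $m\ge 0$; $\nu_p$ is the $p$-adic valuation. $S(n,k)$ is a minimum zero case (MZC) if $\nu_p(S(n,k))=(\sigma_p(k)-\sigma_p(n))/(p-1)$, and a shifted minimum zero case (SMZC) if $\nu_p(S(n,k))=(\sigma_p(k-1)-\sigma_p(n-1))/(p-1)$. *)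

theory Defs
  imports Complex_Main "HOL-Computational_Algebra.Primes" "HOL-Combinatorics.Stirling"
begin

text \<open>
  The base \<open>p\<close> digit of \<open>m\<close> at position \<open>i\<close> is \<open>m div p ^ i mod p\<close>. For \<open>p \<ge> 2\<close> it vanishes
  for all \<open>i \<ge> m\<close>, as \<open>m < p ^ m\<close>, so the sum below ranges over all nonzero digits.
\<close>

definition digit_sum :: "nat \<Rightarrow> nat \<Rightarrow> nat"
  where "digit_sum p m = (\<Sum>i<m. m div p ^ i mod p)"

text \<open>
  The two predicates are meant for prime \<open>p\<close> and \<open>n \<ge> k \<ge> 1\<close>. Then \<open>Stirling n k\<close> is positive,
  so that \<open>multiplicity\<close> is its \<open>p\<close>-adic valuation (the library sets \<open>multiplicity p 0 = 0\<close>), and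
  the subtractions on \<open>nat\<close> in \<open>SMZC\<close> do not truncate. The right-hand sides are real quotients,
  which need not be integral or nonnegative.
\<close>

definition MZC :: "nat \<Rightarrow> nat \<Rightarrow> nat \<Rightarrow> bool"
  where "MZC p n k \<longleftrightarrow>
    real (multiplicity p (Stirling n k)) =
      (real (digit_sum p k) - real (digit_sum p n)) / (real p - 1)"

definition SMZC :: "nat \<Rightarrow> nat \<Rightarrow> nat \<Rightarrow> bool"
  where "SMZC p n k \<longleftrightarrow>
    real (multiplicity p (Stirling n k)) =
      (real (digit_sum p (k - 1)) - real (digit_sum p (n - 1))) / (real p - 1)"

end

theory Submission
  imports Defs
begin

text \<open>
  Write \<open>\<sigma>\<close> for the base \<open>p\<close> digit sum and \<open>\<nu>\<close> for the \<open>p\<close>-adic valuation. Expanding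
  \<open>S(n + 1, k + 1)\<close> by binomial coefficients in two ways gives
  \<open>(k + 1) S(n, k + 1) = (\<Sum>j<n. (n choose j) S(j, k))\<close>. By Legendre's formula
  \<open>(p - 1) \<nu>(n choose j) = \<sigma>(j) + \<sigma>(n - j) - \<sigma>(n)\<close>, so induction on \<open>k\<close> yields
  \<open>(p - 1) \<nu>((k + 1) S(n, k + 1)) > \<sigma>(k) - \<sigma>(n)\<close>. Hence in the recurrence
  \<open>S(n + 1, k + 1) = (k + 1) S(n, k + 1) + S(n, k)\<close> the first summand cannot affect whether the
  valuation equals \<open>(\<sigma>(k) - \<sigma>(n)) / (p - 1)\<close>.
\<close>

section \<open>Binomial sums for Stirling numbers\<close>

lemma Stirling_pos:
  assumes "1 \<le> k" "k \<le> n"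
  shows "0 < Stirling n k"
  using assms
proof (induction n arbitrary: k)
  case (Suc n)
  then obtain l where "k = Suc l"
    by (cases k) auto
  with Suc show ?case
    by (cases "l = n") auto
qed simp

text \<open>In a partition of \<open>Suc n\<close> elements into \<open>Suc k\<close> blocks, the
  \<open>j\<close> elements outside the block of a distinguished element form \<open>k\<close>
  blocks. The proof is by Pascal's rule and the Stirling recurrence.\<close>

lemma Stirling_Suc_Suc_eq_sum:
  "Stirling (Suc n) (Suc k) = (\<Sum>j\<le>n. (n choose j) * Stirling j k)"
proof (induction n arbitrary: k)
  case 0
  then show ?case
    by (cases k) auto
next
  case (Suc n)
  have "(\<Sum>j\<le>Suc n. (Suc n choose j) * Stirling j k) =
      Stirling 0 k + (\<Sum>j\<le>n. (Suc n choose Suc j) * Stirling (Suc j) k)"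
    by (subst sum.atMost_Suc_shift) simp
  also have "\<dots> = (Stirling 0 k + (\<Sum>j\<le>n. (n choose Suc j) * Stirling (Suc j) k)) +
      (\<Sum>j\<le>n. (n choose j) * Stirling (Suc j) k)"
    by (simp add: sum.distrib algebra_simps)
  also have "Stirling 0 k + (\<Sum>j\<le>n. (n choose Suc j) * Stirling (Suc j) k) =
      (\<Sum>j\<le>Suc n. (n choose j) * Stirling j k)"
    by (subst sum.atMost_Suc_shift) simp
  also have "\<dots> = Stirling (Suc n) (Suc k)"
    by (simp add: binomial_eq_0 flip: Suc.IH)
  also have "(\<Sum>j\<le>n. (n choose j) * Stirling (Suc j) k) =
      k * Stirling (Suc n) (Suc k) + Stirling (Suc n) k"
  proof (cases k)
    case (Suc l)
    have "(\<Sum>j\<le>n. (n choose j) * Stirling (Suc j) k) =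
        (\<Sum>j\<le>n. k * ((n choose j) * Stirling j k) + (n choose j) * Stirling j l)"
      by (intro sum.cong) (auto simp: Suc algebra_simps)
    also have "\<dots> = k * Stirling (Suc n) (Suc k) + Stirling (Suc n) k"
      \<comment> \<open>The induction hypothesis is needed at both \<open>k\<close> and
        \<open>l\<close>, hence \<open>arbitrary: k\<close>.\<close>
      by (simp only: sum.distrib flip: sum_distrib_left Suc.IH) (simp add: Suc)
    finally show ?thesis .
  qed simp
  finally show ?case
    by simp
qed

text \<open>The term \<open>j = n\<close> of the binomial sum is \<open>Stirling n k\<close>; it
  cancels against the same term in the recurrence.\<close>

lemma Suc_mult_Stirling_eq_sum:
  "Suc k * Stirling n (Suc k) = (\<Sum>j<n. (n choose j) * Stirling j k)"
  using Stirling_Suc_Suc_eq_sum[of n k] by (simp flip: lessThan_Suc_atMost)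

section \<open>Digit sums and Legendre's formula\<close>

lemma digit_sum_eq_sum:
  assumes "p \<ge> 2" "m \<le> N"
  shows "digit_sum p m = (\<Sum>i<N. m div p ^ i mod p)"
proof -
  have "m div p ^ i = 0" if "i \<ge> m" for i
  proof -
    have "i < p ^ i"
      using assms(1) by (simp add: power_gt_expt)
    with that show ?thesis
      by simp
  qed
  then show ?thesis
    unfolding digit_sum_def using assms by (intro sum.mono_neutral_left) auto
qed

lemma digit_sum_rec:
  assumes "p \<ge> 2"
  shows "digit_sum p m = m mod p + digit_sum p (m div p)"
proof -
  \<comment> \<open>The extra index leaves the value unchanged and makes room to split off the last
    digit, even for \<open>m = 0\<close>.\<close>
  have "digit_sum p m = (\<Sum>i<Suc m. m div p ^ i mod p)"
    using assms by (intro digit_sum_eq_sum) auto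
  also have "\<dots> = m mod p + (\<Sum>i<m. m div p div p ^ i mod p)"
    by (subst sum.lessThan_Suc_shift) (simp add: div_mult2_eq)
  also have "(\<Sum>i<m. m div p div p ^ i mod p) = digit_sum p (m div p)"
    using assms by (intro digit_sum_eq_sum[symmetric]) auto
  finally show ?thesis .
qed

text \<open>Adding 1 turns each trailing digit \<open>p - 1\<close> into 0 and raises the next digit
  by 1; \<open>multiplicity p (Suc m)\<close> counts these trailing digits.\<close>

lemma digit_sum_Suc:
  assumes "prime p"
  shows "digit_sum p (Suc m) + (p - 1) * multiplicity p (Suc m) = Suc (digit_sum p m)"
proof (induction m rule: less_induct)
  case (less m)
  have p: "p \<ge> 2"
    using assms by (rule prime_ge_2_nat)
  show ?case
  proof (cases "p dvd Suc m")
    case False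
    then have "Suc m mod p = Suc (m mod p)" "Suc m div p = m div p"
      by (auto simp: mod_Suc div_Suc dvd_eq_mod_eq_0)
    then show ?thesis
      using False digit_sum_rec[OF p, of m] digit_sum_rec[OF p, of "Suc m"]
      by (simp add: not_dvd_imp_multiplicity_0)
  next
    case True
    then obtain q where "Suc m = p * q" ..
    then obtain l where l: "Suc m = p * Suc l"
      by (cases q) auto
    \<comment> \<open>The last digit of \<open>m\<close> is \<open>p - 1\<close>, so the carry
      passes on to \<open>l\<close>, where the induction hypothesis applies.\<close>
    then have m: "m = (p - 1) + p * l"
      using p by simp
    have "m mod p = p - 1" "m div p = l"
      using p unfolding m by (simp_all only: mod_mult_self2 div_mult_self2) auto
    moreover have "1 * l \<le> p * l"
      using p by (intro mult_le_mono1) simp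
    then have "l < m"
      unfolding m using p by linarith
    then have "digit_sum p (Suc l) + (p - 1) * multiplicity p (Suc l) = Suc (digit_sum p l)"
      by (rule less)
    moreover have "multiplicity p (Suc m) = Suc (multiplicity p (Suc l))"
      unfolding l using assms p by (intro multiplicity_times_same) auto
    moreover have "digit_sum p (Suc m) = digit_sum p (Suc l)"
      using p by (subst digit_sum_rec[OF p]) (simp add: l del: mult_Suc_right)
    ultimately show ?thesis
      using digit_sum_rec[OF p, of m] p by simp
  qed
qed

lemma digit_sum_pos:
  assumes "p \<ge> 2" "m > 0"
  shows "digit_sum p m > 0"
  using assms(2)
proof (induction m rule: less_induct)
  case (less m)
  show ?case
  proof (cases "m div p = 0")
    case True
    then have "m mod p = m"
      using assms by (auto simp: div_eq_0_iff)
    with less.prems show ?thesis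
      using digit_sum_rec[OF assms(1), of m] by simp
  next
    case False
    then have "digit_sum p (m div p) > 0"
      using less assms by simp
    then show ?thesis
      using digit_sum_rec[OF assms(1), of m] by simp
  qed
qed

text \<open>Legendre's formula, obtained by summing \<open>digit_sum_Suc\<close>; the additive form
  avoids truncated subtraction.\<close>

lemma multiplicity_fact_digit_sum:
  assumes "prime p"
  shows "(p - 1) * multiplicity p (fact m :: nat) + digit_sum p m = m"
proof (induction m)
  case 0
  then show ?case
    by (simp add: digit_sum_def)
next
  case (Suc m)
  have "multiplicity p (fact (Suc m) :: nat) = multiplicity p (Suc m) + multiplicity p (fact m :: nat)"
    using assms by (simp add: prime_elem_multiplicity_mult_distrib del: mult_Suc)
  then show ?case
    using Suc digit_sum_Suc[OF assms, of m] by (simp add: algebra_simps)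
qed

lemma multiplicity_binomial_digit_sum:
  assumes "prime p" "j \<le> n"
  shows "(p - 1) * multiplicity p (n choose j) + digit_sum p n = digit_sum p j + digit_sum p (n - j)"
proof -
  have "multiplicity p (fact n :: nat) = multiplicity p (fact j * fact (n - j) * (n choose j))"
    using assms(2) by (simp only: binomial_fact_lemma)
  also have "\<dots> = multiplicity p (fact j :: nat) + multiplicity p (fact (n - j) :: nat) +
      multiplicity p (n choose j)"
    using assms by (simp add: prime_elem_multiplicity_mult_distrib)
  finally have "(p - 1) * multiplicity p (fact n :: nat) = (p - 1) * multiplicity p (fact j :: nat) +
      (p - 1) * multiplicity p (fact (n - j) :: nat) + (p - 1) * multiplicity p (n choose j)"
    by (simp add: algebra_simps)
  then show ?thesis
    using multiplicity_fact_digit_sum[OF assms(1), of n] multiplicity_fact_digit_sum[OF assms(1), of j]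
      multiplicity_fact_digit_sum[OF assms(1), of "n - j"] assms(2) by linarith
qed

section \<open>Lower bounds for valuations of Stirling numbers\<close>

lemma multiplicity_sum_ge_summand:
  fixes f :: "'a \<Rightarrow> nat"
  assumes "prime p" "sum f A \<noteq> 0"
  obtains j where "j \<in> A" "f j \<noteq> 0" "multiplicity p (f j) \<le> multiplicity p (sum f A)"
proof -
  have p: "\<not> is_unit p"
    using assms(1) by auto
  \<comment> \<open>If this power divided every summand, it would divide the sum. The summand found
    is nonzero, so its valuation is not the default \<open>multiplicity p 0 = 0\<close>.\<close>
  have "\<not> p ^ Suc (multiplicity p (sum f A)) dvd sum f A"
    using multiplicity_geI[OF assms(2) p] not_less_eq_eq by blast
  then obtain j where j: "j \<in> A" "\<not> p ^ Suc (multiplicity p (sum f A)) dvd f j"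
    by (meson dvd_sum)
  then have "f j \<noteq> 0"
    by (metis dvd_0_right)
  moreover from j(2) have "multiplicity p (f j) \<le> multiplicity p (sum f A)"
    using multiplicity_dvd' not_less_eq_eq by blast
  ultimately show ?thesis
    using that j(1) by blast
qed

text \<open>Strictness comes from \<open>j < n\<close>, which makes
  \<open>digit_sum p (n - j)\<close> positive. The bound for \<open>k\<close> is a premise so that
  the lemma serves both inside the induction and after it.\<close>

lemma multiplicity_Suc_mult_Stirling_step:
  assumes p: "prime p" and nz: "Stirling n (Suc k) \<noteq> 0"
    and IH: "\<And>j. Stirling j k \<noteq> 0 \<Longrightarrow>
      digit_sum p k \<le> digit_sum p j + (p - 1) * multiplicity p (Stirling j k)"
  shows "digit_sum p k < digit_sum p n + (p - 1) * multiplicity p (Suc k * Stirling n (Suc k))"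
proof -
  let ?N = "Suc k * Stirling n (Suc k)"
  have "(\<Sum>j<n. (n choose j) * Stirling j k) \<noteq> 0"
    using nz by (simp flip: Suc_mult_Stirling_eq_sum del: mult_Suc)
  then obtain j where j: "j < n" "(n choose j) * Stirling j k \<noteq> 0"
    and le: "multiplicity p ((n choose j) * Stirling j k) \<le> multiplicity p ?N"
    using multiplicity_sum_ge_summand[OF p] unfolding Suc_mult_Stirling_eq_sum by blast
  have "digit_sum p (n - j) > 0"
    using j prime_ge_2_nat[OF p] by (intro digit_sum_pos) auto
  moreover have "digit_sum p k \<le> digit_sum p j + (p - 1) * multiplicity p (Stirling j k)"
    using j by (intro IH) auto
  moreover have "(p - 1) * multiplicity p ((n choose j) * Stirling j k) =
      (p - 1) * multiplicity p (n choose j) + (p - 1) * multiplicity p (Stirling j k)"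
    using j p by (simp add: prime_elem_multiplicity_mult_distrib algebra_simps)
  moreover have "(p - 1) * multiplicity p ((n choose j) * Stirling j k) \<le> (p - 1) * multiplicity p ?N"
    using le by simp
  ultimately show ?thesis
    using multiplicity_binomial_digit_sum[OF p, of j n] j by linarith
qed

lemma digit_sum_le_multiplicity_Stirling:
  assumes p: "prime p" and "Stirling n k \<noteq> 0"
  shows "digit_sum p k \<le> digit_sum p n + (p - 1) * multiplicity p (Stirling n k)"
  using assms(2)
proof (induction k arbitrary: n)
  case 0
  then show ?case
    by (simp add: digit_sum_def)
next
  case (Suc k)
  have "digit_sum p k < digit_sum p n + (p - 1) * multiplicity p (Suc k * Stirling n (Suc k))"
    using p Suc.prems Suc.IH by (rule multiplicity_Suc_mult_Stirling_step)
  moreover have "(p - 1) * multiplicity p (Suc k * Stirling n (Suc k)) =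
      (p - 1) * multiplicity p (Suc k) + (p - 1) * multiplicity p (Stirling n (Suc k))"
    using Suc.prems p by (simp add: prime_elem_multiplicity_mult_distrib algebra_simps del: mult_Suc)
  ultimately show ?case
    \<comment> \<open>Removing the factor \<open>Suc k\<close> costs
      \<open>(p - 1) * multiplicity p (Suc k)\<close>, and the strict inequality supplies the 1 in
      \<open>digit_sum_Suc\<close>.\<close>
    using digit_sum_Suc[OF p, of k] by linarith
qed

lemma digit_sum_less_multiplicity_Suc_mult_Stirling:
  assumes "prime p" "Stirling n (Suc k) \<noteq> 0"
  shows "digit_sum p k < digit_sum p n + (p - 1) * multiplicity p (Suc k * Stirling n (Suc k))"
  using assms by (rule multiplicity_Suc_mult_Stirling_step) (rule digit_sum_le_multiplicity_Stirling[OF assms(1)])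

text \<open>The ultrametric inequality, with equality when the valuations differ. The case
  \<open>c = 0\<close> is set apart because \<open>multiplicity p 0 = 0\<close> stands in for an
  infinite valuation.\<close>

lemma multiplicity_add_eq_or_ge:
  fixes a c :: nat
  assumes "prime p" "a \<noteq> 0"
  shows "multiplicity p (c + a) = multiplicity p a \<or>
    c \<noteq> 0 \<and> multiplicity p c \<le> multiplicity p a \<and> multiplicity p c \<le> multiplicity p (c + a)"
proof (cases "c = 0 \<or> multiplicity p a < multiplicity p c")
  case True
  then show ?thesis
    using assms multiplicity_sum_lt[of p a c] by (cases "c = 0") (auto simp: add.commute)
next
  case False
  have "p ^ multiplicity p c dvd c + a"
    using False by (intro dvd_add multiplicity_dvd multiplicity_dvd') auto
  then have "multiplicity p c \<le> multiplicity p (c + a)"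
    using assms by (intro multiplicity_geI) auto
  with False show ?thesis
    by auto
qed

theorem theorem3p22:
  fixes p n k :: nat
  assumes "prime p" and "n \<ge> k" and "k \<ge> 1"
  shows "(MZC p n k \<longleftrightarrow> SMZC p (n + 1) (k + 1)) \<and>
    (MZC p n k \<or> SMZC p (n + 1) (k + 1) \<longrightarrow>
      multiplicity p (Stirling n k) = multiplicity p (Stirling (n + 1) (k + 1)) \<and>
      real (multiplicity p (Stirling (n + 1) (k + 1))) =
        (real (digit_sum p k) - real (digit_sum p n)) / (real p - 1))"
proof -
  have p: "p \<ge> 2"
    using assms(1) by (rule prime_ge_2_nat)
  \<comment> \<open>Clearing the denominator \<open>p - 1 > 0\<close> reduces the real equation to
    one over \<open>nat\<close> without subtraction of digit sums.\<close>
  have minimal: "real v = (real (digit_sum p k) - real (digit_sum p n)) / (real p - 1) \<longleftrightarrow>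
      digit_sum p k = digit_sum p n + (p - 1) * v" for v
  proof -
    have "real v = (real (digit_sum p k) - real (digit_sum p n)) / (real p - 1) \<longleftrightarrow>
        real (digit_sum p k) = real (digit_sum p n + (p - 1) * v)"
      using p by (auto simp: field_simps of_nat_diff)
    then show ?thesis
      by (simp only: of_nat_eq_iff)
  qed
  let ?c = "Suc k * Stirling n (Suc k)"
  \<comment> \<open>By the recurrence, \<open>Stirling (n + 1) (k + 1)\<close> is
    \<open>?c + Stirling n k\<close>. The shift gives both predicates the same right-hand
    side.\<close>
  consider (eq) "multiplicity p (Stirling (n + 1) (k + 1)) = multiplicity p (Stirling n k)"
    | (ge) "Stirling n (Suc k) \<noteq> 0" "multiplicity p ?c \<le> multiplicity p (Stirling n k)"
      "multiplicity p ?c \<le> multiplicity p (Stirling (n + 1) (k + 1))"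
    using multiplicity_add_eq_or_ge[OF assms(1), of "Stirling n k" ?c] Stirling_pos[OF assms(3,2)]
    by auto
  then show ?thesis
  proof cases
    case eq
    then show ?thesis
      by (simp add: MZC_def SMZC_def)
  next
    case ge
    \<comment> \<open>Both valuations are at least that of \<open>?c\<close>, hence exceed the
      common right-hand side, and both predicates fail.\<close>
    have "digit_sum p k < digit_sum p n + (p - 1) * v" if "multiplicity p ?c \<le> v" for v
      using digit_sum_less_multiplicity_Suc_mult_Stirling[OF assms(1) ge(1)]
        mult_le_mono2[OF that, of "p - 1"] by linarith
    from this[OF ge(2)] this[OF ge(3)] show ?thesis
      unfolding MZC_def SMZC_def diff_add_inverse2 minimal by linarith
  qed
qed

end
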